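(* Let $G$ be a computable amenable group which is finitely generated, and fix a finite symmetric generating set $S$ of $G$. Consider the Cayley graph of $G$ with respect to $S$, i.e. the graph with vertex set $G$ in which $h$ is joined to $sh$ for every $h\in G$, $s\in S$. Let $(F_i)$ be a Følner sequence in $G$. If each $F_i$ is a connected subset of the Cayley graph (that is, the subgraph induced on $F_i$ is connected) and contains the group identity, then $(F_i)$ is a modest Følner sequence, i.e. $C(F_i)=o(|F_i|)$.
   Context: A computable group is a countable group whose set of elements is the set $\mathbb{N}$ of natural numbers and whose multiplication $(g,h)\mapsto gh$ is a computable function (we may assume that $0$ is the identity). A Følner sequence in $G$ is a sequence $(F_i)$ of finite nonempty subsets of $G$ with $\lim_{i\to\infty} |gF_i \setminus F_i|/|F_i| = 0$ for every $g\in G$; $G$ is amenable if it has a Følner sequence. Kolmogorov complexity. Let $2^*$ be the set of finite binary strings and $|x|$ the length of $x$. For a partial computable $f:2^*\to 2^*$ let $C_f(x)=\min\{|y| : f(y)=x\}$ ($+\infty$ if there is no such $y$). Fix an optimal $f$: for every partial computable $f'$ there is a constant $K$ with $C_f(x) < C_{f'}(x)+K$ for all $x$; put $C(x)=C_f(x)$. Complexity of natural numbers is defined by identifying $2^*$ with $\mathbb{N}$ via the length-then-lexicographic enumeration. Complexity of a finite subset of $\mathbb{N}$ (in particular of a finite subset of $G$) is the complexity of its index under a fixed natural enumeration, i.e. an injection $q$ from the finite subsets of $\mathbb{N}$ onto a decidable subset of $\mathbb{N}$ for which $(q(w),u)\mapsto q(w\cup\{u\})$ is computable. Different choices of $q$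 change complexities only by $O(1)$. *)

theory Defs
  imports
    "HOL-Library.Landau_Symbols"
    "HOL-Library.Extended_Nat"
    "HOL-Algebra.Algebra"
    "Graph_Theory.Digraph_Component"
begin

section \<open>Partial recursive functions\<close>

text \<open>
  Kleene's partial recursive functions.  A code denotes a partial function on argument lists;
  codes carry no arity, and a function applied to too few arguments is undefined.
\<close>

datatype recf =
    Zero
  | Succ
  | Proj nat
  | Comp recf "recf list"
  | PrimRec recf recf
  | Minimize recf

definition least_zero :: "(nat \<Rightarrow> nat option) \<Rightarrow> nat option" where
  "least_zero h = (if \<exists>n. h n = Some 0 \<and> (\<forall>m<n. h m \<noteq> None)
                   then Some (LEAST n. h n = Some 0) else None)"

fun recf_eval :: "recf \<Rightarrow> nat list \<Rightarrow> nat option" where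
  "recf_eval Zero xs = Some 0"
| "recf_eval Succ xs = (case xs of [] \<Rightarrow> None | x # _ \<Rightarrow> Some (Suc x))"
| "recf_eval (Proj i) xs = (if i < length xs then Some (xs ! i) else None)"
| "recf_eval (Comp f gs) xs = Option.bind (those (map (\<lambda>g. recf_eval g xs) gs)) (recf_eval f)"
| "recf_eval (PrimRec f g) xs =
     (case xs of [] \<Rightarrow> None
      | n # ys \<Rightarrow> rec_nat (recf_eval f ys)
                    (\<lambda>m r. Option.bind r (\<lambda>y. recf_eval g (m # y # ys))) n)"
| "recf_eval (Minimize f) xs = least_zero (\<lambda>n. recf_eval f (n # xs))"

definition computable2 :: "(nat \<Rightarrow> nat \<Rightarrow> nat) \<Rightarrow> bool" where
  "computable2 h \<longleftrightarrow> (\<exists>p. \<forall>x y. recf_eval p [x, y] = Some (h x y))"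

definition decidable :: "nat set \<Rightarrow> bool" where
  "decidable A \<longleftrightarrow> (\<exists>p. \<forall>n. recf_eval p [n] = Some (if n \<in> A then 1 else 0))"


section \<open>Binary strings\<close>

text \<open>
  The position of a string in the length-then-lexicographic enumeration (starting at 0) is one
  less than the number whose binary expansion is the string preceded by a digit 1; see
  \<open>str_index_less_iff\<close> and \<open>bij_str_index\<close> below.
\<close>

definition str_index :: "bool list \<Rightarrow> nat" where
  "str_index x = foldl (\<lambda>n b. 2 * n + 1 + of_bool b) 0 x"

definition str_of_index :: "nat \<Rightarrow> bool list" where
  "str_of_index = inv_into UNIV str_index"

lemma str_index_Nil [simp]: "str_index [] = 0"
  by (simp add: str_index_def)

lemma str_index_snoc: "str_index (x @ [b]) = 2 * str_index x + 1 + of_bool b"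
  by (simp add: str_index_def)

lemma str_index_Cons: "str_index (b # x) + 1 = (1 + of_bool b) * 2 ^ length x + (str_index x + 1)"
proof (induction x rule: rev_induct)
  case Nil
  then show ?case by (simp add: str_index_def)
next
  case (snoc a x)
  have "str_index (b # x @ [a]) = 2 * str_index (b # x) + 1 + of_bool a"
    using str_index_snoc [of "b # x" a] by simp
  then show ?case using snoc by (simp add: str_index_snoc algebra_simps)
qed

lemma str_index_bounds: "2 ^ length x \<le> str_index x + 1" "str_index x + 1 < 2 ^ Suc (length x)"
  by (induction x rule: rev_induct) (auto simp: str_index_snoc of_bool_def)

lemma str_index_mono:
  assumes "(x, y) \<in> lenlex {(False, True)}"
  shows "str_index x < str_index y"
  using assms
proof (induction x arbitrary: y)
  case Nil
  then obtain b z where "y = b # z" by (cases y) auto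
  then show ?case using str_index_Cons [of b z] by simp
next
  case (Cons a x)
  then obtain b z where y: "y = b # z" by (cases y) auto
  consider "length x < length z"
    | "length x = length z" "\<not> a" "b"
    | "a = b" "(x, z) \<in> lenlex {(False, True)}" "length x = length z"
    using Cons.prems lenlex_length [of x z] by (force simp: y Cons_lenlex_iff le_less)
  then show ?case
  proof cases
    case 1
    have "(2::nat) ^ Suc (length (a # x)) \<le> 2 ^ length y"
      using 1 y by (intro power_increasing) auto
    then show ?thesis using str_index_bounds [of "a # x"] str_index_bounds [of y] by linarith
  next
    case 2
    then show ?thesis
      using str_index_Cons [of a x] str_index_Cons [of b z] str_index_bounds [of x]
        str_index_bounds [of z] y by simp
  next
    case 3
    then show ?thesis
      using str_index_Cons [of a x] str_index_Cons [of b z] Cons.IH [OF 3(2)] y by simp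
  qed
qed

lemma str_index_less_iff: "str_index x < str_index y \<longleftrightarrow> (x, y) \<in> lenlex {(False, True)}"
proof -
  have "total (lenlex {(False, True)})"
    by (rule total_lenlex) (auto simp: total_on_def)
  then have "(x, y) \<in> lenlex {(False, True)} \<or> x = y \<or> (y, x) \<in> lenlex {(False, True)}"
    by (auto simp: total_on_def)
  then show ?thesis using str_index_mono less_asym by blast
qed

lemma bij_str_index: "bij str_index"
proof (rule bijI)
  show "inj str_index"
  proof (rule injI)
    fix x y assume eq: "str_index x = str_index y"
    have "total (lenlex {(False, True)})"
      by (rule total_lenlex) (auto simp: total_on_def)
    then show "x = y" using str_index_mono eq by (metis UNIV_I less_irrefl total_on_def)
  qed
  have "\<exists>x. n = str_index x" for n
  proof (induction n rule: less_induct)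
    case (less n)
    show ?case
    proof (cases "n = 0")
      case True
      then show ?thesis by (intro exI [of _ "[]"]) simp
    next
      case False
      then have "(n - 1) div 2 < n" by linarith
      then obtain x where x: "(n - 1) div 2 = str_index x" using less by blast
      have "n = str_index (x @ [even n])"
        using False by (auto simp: str_index_snoc simp flip: x)
      then show ?thesis by blast
    qed
  qed
  then show "surj str_index" by (auto simp: surj_def)
qed


section \<open>Kolmogorov complexity\<close>

definition partial_computable :: "(bool list \<Rightarrow> bool list option) \<Rightarrow> bool" where
  "partial_computable f \<longleftrightarrow>
     (\<exists>p. \<forall>y. recf_eval p [str_index y] = map_option str_index (f y))"

text \<open>The infimum is a minimum, and it is \<open>\<infinity>\<close> when there is no \<open>y\<close> with \<open>f y = Some x\<close>.\<close>

definition complexity :: "(bool list \<Rightarrow> bool list option) \<Rightarrow> bool list \<Rightarrow> enat" where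
  "complexity f x = (INF y \<in> {y. f y = Some x}. enat (length y))"

definition optimal :: "(bool list \<Rightarrow> bool list option) \<Rightarrow> bool" where
  "optimal f \<longleftrightarrow> partial_computable f \<and>
     (\<forall>f'. partial_computable f' \<longrightarrow>
        (\<exists>K::nat. \<forall>x. complexity f x < complexity f' x + enat K))"

lemma optimal_complexity_finite:
  assumes "optimal f"
  shows "complexity f x \<noteq> \<infinity>"
proof -
  have "partial_computable Some"
    unfolding partial_computable_def by (intro exI [of _ "Proj 0"]) simp
  then obtain K where "complexity f x < complexity Some x + enat K"
    using assms unfolding optimal_def by blast
  then show ?thesis by (metis enat_ord_simps(6))
qed

text \<open>
  A natural enumeration is an indexing of the finite sets of naturals.  The inner code is only
  constrained on the (decidable) set of pairs \<open>(q w, u)\<close>, the domain of the computable function.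
  Values of \<open>q\<close> at infinite sets are irrelevant.
\<close>

definition natural_enumeration :: "(nat set \<Rightarrow> nat) \<Rightarrow> bool" where
  "natural_enumeration q \<longleftrightarrow>
     inj_on q {w. finite w} \<and>
     decidable (q ` {w. finite w}) \<and>
     (\<exists>p. \<forall>w u. finite w \<longrightarrow> recf_eval p [q w, u] = Some (q (w \<union> {u})))"

definition nat_complexity :: "(bool list \<Rightarrow> bool list option) \<Rightarrow> nat \<Rightarrow> enat" where
  "nat_complexity f n = complexity f (str_of_index n)"

definition set_complexity ::
    "(bool list \<Rightarrow> bool list option) \<Rightarrow> (nat set \<Rightarrow> nat) \<Rightarrow> nat set \<Rightarrow> enat" where
  "set_complexity f q w = nat_complexity f (q w)"


section \<open>Groups\<close>

text \<open>The identity is not required to be the number 0.\<close>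

definition computable_group :: "(nat, 'b) monoid_scheme \<Rightarrow> bool" where
  "computable_group G \<longleftrightarrow> group G \<and> carrier G = UNIV \<and> computable2 (\<lambda>g h. g \<otimes>\<^bsub>G\<^esub> h)"

definition Folner_sequence :: "('a, 'b) monoid_scheme \<Rightarrow> (nat \<Rightarrow> 'a set) \<Rightarrow> bool" where
  "Folner_sequence G F \<longleftrightarrow>
     (\<forall>i. F i \<subseteq> carrier G \<and> finite (F i) \<and> F i \<noteq> {}) \<and>
     (\<forall>g \<in> carrier G.
        (\<lambda>i. real (card ((g <#\<^bsub>G\<^esub> F i) - F i)) / real (card (F i))) \<longlonglongrightarrow> 0)"

definition amenable :: "('a, 'b) monoid_scheme \<Rightarrow> bool" where
  "amenable G \<longleftrightarrow> (\<exists>F. Folner_sequence G F)"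

text \<open>
  \<open>the_enat\<close> loses nothing: by \<open>optimal_complexity_finite\<close>, complexities are finite when \<open>f\<close> is
  optimal.
\<close>

definition modest_Folner_sequence ::
    "(bool list \<Rightarrow> bool list option) \<Rightarrow> (nat set \<Rightarrow> nat) \<Rightarrow> (nat, 'b) monoid_scheme
       \<Rightarrow> (nat \<Rightarrow> nat set) \<Rightarrow> bool" where
  "modest_Folner_sequence f q G F \<longleftrightarrow>
     Folner_sequence G F \<and>
     (\<lambda>i. real (the_enat (set_complexity f q (F i)))) \<in> o(\<lambda>i. real (card (F i)))"

definition symmetric_generating_set :: "('a, 'b) monoid_scheme \<Rightarrow> 'a set \<Rightarrow> bool" where
  "symmetric_generating_set G S \<longleftrightarrow>
     S \<subseteq> carrier G \<and> (\<forall>s \<in> S. inv\<^bsub>G\<^esub> s \<in> S) \<and> generate G S = carrier G"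

text \<open>
  For symmetric \<open>S\<close> the arc set is symmetric, so the digraph represents the undirected Cayley
  graph.
\<close>

definition cayley_graph :: "('a, 'b) monoid_scheme \<Rightarrow> 'a set \<Rightarrow> ('a, 'a \<times> 'a) pre_digraph" where
  "cayley_graph G S =
     \<lparr> verts = carrier G, arcs = {(h, s \<otimes>\<^bsub>G\<^esub> h) | h s. h \<in> carrier G \<and> s \<in> S},
       tail = fst, head = snd \<rparr>"

definition connected_subset :: "('a, 'c) pre_digraph \<Rightarrow> 'a set \<Rightarrow> bool" where
  "connected_subset \<Gamma> A \<longleftrightarrow> A \<subseteq> verts \<Gamma> \<and> Digraph_Component.connected (\<Gamma> \<restriction> A)"

end

theory Submission
  imports Defs
begin

text \<open>
  Explore \<open>F i\<close> from the identity, keeping a set of accepted and a set of rejected vertices.  The next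
  vertex to be decided is always the least undecided neighbour of an accepted vertex, which is
  accepted exactly if it lies in \<open>F i\<close>.  As \<open>F i\<close> is connected, this ends with all of \<open>F i\<close>
  accepted.  Nothing but the word of decisions is needed to repeat the exploration, since the group is
  computable.  Now every rejected vertex belongs to the outer boundary of \<open>F i\<close>, which by the Folner
  property has \<open>o(card (F i))\<close> elements: the word has fewer than \<open>card (F i)\<close> acceptances and very few
  rejections (\<open>exists_exploration\<close>).

  Such a word is compressible.  Fix \<open>L\<close> and write the word in an alphabet with letters for one
  acceptance, for one rejection and for \<open>L\<close> acceptances in a row.  With \<open>n\<close> acceptances and \<open>m\<close>
  rejections, at most \<open>n / L + (L + 1) (m + 1)\<close> letters suffice (\<open>word_compression\<close>), and the letters
  are taken as base 4 digits of a number (\<open>exists_number_with_digits\<close>).  Hence the complexity of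
  \<open>F i\<close> is at most \<open>2 / L\<close> times its size, up to \<open>o(card (F i))\<close> and a constant depending on \<open>L\<close>
  (\<open>complexity_of_explorable_set\<close>).  The constant is harmless because \<open>card (F i)\<close> tends to infinity
  (\<open>Folner_sequence_card_at_top\<close>), and \<open>L\<close> is arbitrary, so the complexity is \<open>o(card (F i))\<close>.

  The decoder has to be written as a partial recursive function (\<open>recursive_on_decode\<close>).  It works on
  codes of finite sets, for which insertion is computable by assumption and membership is computable
  as a consequence (\<open>recursive_on_member\<close>); the next vertex is found by minimization.
\<close>

section \<open>A calculus of recursive functions\<close>

text \<open>
  The index \<open>s\<close> ranges over mathematical situations, such as tuples of finite sets, and the list
  \<open>x s\<close> holds the numbers by which a program sees them.  Since the program has to be right only for
  \<open>s \<in> D\<close>, a partial function is treated as a total function \<open>h\<close> together with a set \<open>D\<close> on which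
  its computation is known to converge.
\<close>

definition recursive_on :: "'a set \<Rightarrow> ('a \<Rightarrow> nat list) \<Rightarrow> ('a \<Rightarrow> nat) \<Rightarrow> bool" where
  "recursive_on D x h \<longleftrightarrow> (\<exists>p. \<forall>s\<in>D. recf_eval p (x s) = Some (h s))"

lemma recursive_on_cong:
  "recursive_on D x h \<Longrightarrow> (\<And>s. s \<in> D \<Longrightarrow> h s = h' s) \<Longrightarrow> recursive_on D x h'"
  by (auto simp: recursive_on_def)

lemma those_map_Some:
  "(\<And>g. g \<in> set gs \<Longrightarrow> e g = Some (h g)) \<Longrightarrow> those (map e gs) = Some (map h gs)"
  by (induction gs) auto

text \<open>
  The situation \<open>\<phi> s\<close> for the outer program is given by its entries, which the programs for \<open>gs\<close>
  compute from \<open>x s\<close>.  This also serves to change the list of arguments.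
\<close>

lemma recursive_on_compose:
  assumes f: "recursive_on E y f"
    and gs: "\<And>g. g \<in> set gs \<Longrightarrow> recursive_on D x g"
    and env: "\<And>s. s \<in> D \<Longrightarrow> \<phi> s \<in> E \<and> y (\<phi> s) = map (\<lambda>g. g s) gs"
  shows "recursive_on D x (\<lambda>s. f (\<phi> s))"
proof -
  obtain pf where pf: "\<forall>t\<in>E. recf_eval pf (y t) = Some (f t)"
    using f by (auto simp: recursive_on_def)
  obtain P where P: "\<And>g s. g \<in> set gs \<Longrightarrow> s \<in> D \<Longrightarrow> recf_eval (P g) (x s) = Some (g s)"
    using gs unfolding recursive_on_def by metis
  have "recf_eval (Comp pf (map P gs)) (x s) = Some (f (\<phi> s))" if s: "s \<in> D" for s
  proof -
    have "those (map ((\<lambda>g. recf_eval g (x s)) \<circ> P) gs) = Some (map (\<lambda>g. g s) gs)"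
      using P s by (intro those_map_Some) auto
    moreover have "recf_eval pf (map (\<lambda>g. g s) gs) = Some (f (\<phi> s))"
      using pf env[OF s] by metis
    ultimately show ?thesis by simp
  qed
  then show ?thesis unfolding recursive_on_def by blast
qed

lemma recursive_on_proj:
  assumes "\<And>s. s \<in> D \<Longrightarrow> i < length (x s) \<and> x s ! i = h s"
  shows "recursive_on D x h"
  unfolding recursive_on_def using assms by (intro exI[of _ "Proj i"]) auto

lemma recursive_on_Suc:
  assumes "recursive_on D x a"
  shows "recursive_on D x (\<lambda>s. Suc (a s))"
proof -
  have "recursive_on UNIV (\<lambda>n. [n]) Suc"
    unfolding recursive_on_def by (intro exI[of _ Succ]) auto
  from recursive_on_compose[OF this, of "[a]" D x a] show ?thesis using assms by simp
qed

lemma recursive_on_const: "recursive_on D x (\<lambda>s. c)"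
proof (induction c)
  case 0
  show ?case unfolding recursive_on_def by (intro exI[of _ Zero]) auto
next
  case (Suc c)
  then show ?case by (rule recursive_on_Suc)
qed

text \<open>
  The recursion runs on mathematical objects of an arbitrary type, which \<open>e\<close> turns into numbers.  The
  program for \<open>g\<close> never meets a number outside the range of \<open>e\<close>, so no decoding is required, and \<open>E\<close>
  need only contain the situations that the loop passes through.  The arity \<open>k\<close> is there because the
  program must copy the arguments \<open>x s\<close> unchanged by projections.
\<close>

lemma recursive_on_rec:
  assumes base: "recursive_on D x (\<lambda>s. e (f s))"
    and count: "recursive_on D x n"
    and step: "recursive_on E (\<lambda>t. fst t # e (fst (snd t)) # x (snd (snd t)))
                 (\<lambda>t. e (g (fst t) (fst (snd t)) (snd (snd t))))"
    and dom: "\<And>s m. s \<in> D \<Longrightarrow> m < n s \<Longrightarrow> (m, rec_nat (f s) (\<lambda>m c. g m c s) m, s) \<in> E"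
    and arity: "\<And>s. s \<in> D \<Longrightarrow> length (x s) = k"
  shows "recursive_on D x (\<lambda>s. e (rec_nat (f s) (\<lambda>m c. g m c s) (n s)))"
proof -
  obtain pf where pf: "\<forall>s\<in>D. recf_eval pf (x s) = Some (e (f s))"
    using base by (auto simp: recursive_on_def)
  obtain pn where pn: "\<forall>s\<in>D. recf_eval pn (x s) = Some (n s)"
    using count by (auto simp: recursive_on_def)
  obtain pg where pg: "\<And>m c s. (m, c, s) \<in> E \<Longrightarrow> recf_eval pg (m # e c # x s) = Some (e (g m c s))"
    using step unfolding recursive_on_def by fastforce
  have "recf_eval (Comp (PrimRec pf pg) (pn # map Proj [0..<k])) (x s)
          = Some (e (rec_nat (f s) (\<lambda>m c. g m c s) (n s)))" if s: "s \<in> D" for s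
  proof -
    have "those (map ((\<lambda>g. recf_eval g (x s)) \<circ> Proj) [0..<k]) = Some (map ((!) (x s)) [0..<k])"
      using arity[OF s] by (intro those_map_Some) auto
    moreover have "map ((!) (x s)) [0..<k] = x s"
      using arity[OF s] map_nth by blast
    ultimately have args: "those (map (\<lambda>g. recf_eval g (x s)) (pn # map Proj [0..<k]))
        = Some (n s # x s)"
      using pn s by (simp add: comp_def)
    have "rec_nat (recf_eval pf (x s)) (\<lambda>m r. Option.bind r (\<lambda>y. recf_eval pg (m # y # x s))) m
        = Some (e (rec_nat (f s) (\<lambda>m c. g m c s) m))" if "m \<le> n s" for m
      using that
    proof (induction m)
      case 0
      then show ?case using pf s by simp
    next
      case (Suc m)
      then show ?case using pg[OF dom[OF s, of m]] by simp
    qed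
    then show ?thesis using args by simp
  qed
  then show ?thesis unfolding recursive_on_def by blast
qed

text \<open>
  Minimization looks for a zero, hence the negation.  It diverges if a test before the first success
  does, which is why \<open>E\<close> must contain \<open>(n, s)\<close> for every \<open>n\<close>.
\<close>

lemma recursive_on_Least:
  assumes f: "recursive_on E (\<lambda>t. fst t # x (snd t)) (\<lambda>t. of_bool (\<not> P (fst t) (snd t)))"
    and ex: "\<And>s. s \<in> D \<Longrightarrow> \<exists>n. P n s"
    and dom: "\<And>s n. s \<in> D \<Longrightarrow> (n, s) \<in> E"
  shows "recursive_on D x (\<lambda>s. LEAST n. P n s)"
proof -
  obtain p where p: "\<And>n s. (n, s) \<in> E \<Longrightarrow> recf_eval p (n # x s) = Some (of_bool (\<not> P n s))"
    using f unfolding recursive_on_def by fastforce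
  have "recf_eval (Minimize p) (x s) = Some (LEAST n. P n s)" if s: "s \<in> D" for s
    using ex[OF s] by (auto simp: least_zero_def p dom s)
  then show ?thesis unfolding recursive_on_def by blast
qed


section \<open>Recursive arithmetic\<close>

lemma recursive_on_op2:
  assumes h: "computable2 h" and a: "recursive_on D x a" and b: "recursive_on D x b"
  shows "recursive_on D x (\<lambda>s. h (a s) (b s))"
proof -
  have "recursive_on UNIV (\<lambda>t. [fst t, snd t]) (\<lambda>t. h (fst t) (snd t))"
    using h unfolding computable2_def recursive_on_def by auto
  from recursive_on_compose[OF this, of "[a, b]" D x "\<lambda>s. (a s, b s)"] show ?thesis
    using a b by auto
qed

lemma computable2I:
  assumes "recursive_on UNIV (\<lambda>t. [fst t, snd t]) (\<lambda>t. h (fst t) (snd t))"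
  shows "computable2 h"
  using assms unfolding recursive_on_def computable2_def by auto

text \<open>
  Primitive recursion descends along the first argument, so that subtraction and powers come out with
  their arguments swapped.  The predecessor carries a dummy second argument.
\<close>

lemma computable2_rec:
  assumes base: "recursive_on UNIV (\<lambda>t. [fst t, snd t]) (\<lambda>t. f (snd t))"
    and step: "recursive_on UNIV (\<lambda>t. [fst t, fst (snd t), fst (snd (snd t)), snd (snd (snd t))])
                 (\<lambda>t. g (fst t) (fst (snd t)) (snd (snd (snd t))))"
  shows "computable2 (\<lambda>a b. rec_nat (f b) (\<lambda>m c. g m c b) a)"
proof (rule computable2I)
  show "recursive_on UNIV (\<lambda>t. [fst t, snd t])
          (\<lambda>t. rec_nat (f (snd t)) (\<lambda>m c. g m c (snd t)) (fst t))"
    by (rule recursive_on_rec[where e = "\<lambda>c. c" and E = UNIV and k = 2, OF base])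
      (use step in \<open>auto intro: recursive_on_proj[where i = 0]\<close>)
qed

lemma computable2_swap: "computable2 h \<Longrightarrow> computable2 (\<lambda>a b. h b a)"
  by (rule computable2I, rule recursive_on_op2[of h])
    (auto intro: recursive_on_proj[where i = 0] recursive_on_proj[where i = 1])

lemma computable2_add: "computable2 (\<lambda>a b. a + b)"
proof -
  have "rec_nat b (\<lambda>m c. Suc c) a = a + b" for a b :: nat
    by (induction a) auto
  moreover have "computable2 (\<lambda>a b. rec_nat b (\<lambda>m c. Suc c) a)"
    by (rule computable2_rec[where f = "\<lambda>b. b" and g = "\<lambda>m c b. Suc c"])
      (rule recursive_on_proj[where i = 1], simp, rule recursive_on_Suc,
        (rule recursive_on_proj[where i = 1], simp)+)
  ultimately show ?thesis by simp
qed

lemmas recursive_on_add = recursive_on_op2[OF computable2_add]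

lemma computable2_mult: "computable2 (\<lambda>a b. a * b)"
proof -
  have "rec_nat 0 (\<lambda>m c. c + b) a = a * b" for a b :: nat
    by (induction a) auto
  moreover have "computable2 (\<lambda>a b. rec_nat 0 (\<lambda>m c. c + b) a)"
    by (rule computable2_rec[where f = "\<lambda>b. 0" and g = "\<lambda>m c b. c + b"],
        rule recursive_on_const, rule recursive_on_add)
      (auto intro: recursive_on_proj[where i = 1] recursive_on_proj[where i = 3])
  ultimately show ?thesis by simp
qed

lemmas recursive_on_mult = recursive_on_op2[OF computable2_mult]

lemma computable2_power: "computable2 (\<lambda>a b. b ^ a)"
proof -
  have "rec_nat 1 (\<lambda>m c. c * b) a = b ^ a" for a b :: nat
    by (induction a) auto
  moreover have "computable2 (\<lambda>a b. rec_nat 1 (\<lambda>m c. c * b) a)"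
    by (rule computable2_rec[where f = "\<lambda>b. 1" and g = "\<lambda>m c b. c * b"],
        rule recursive_on_const, rule recursive_on_mult)
      (auto intro: recursive_on_proj[where i = 1] recursive_on_proj[where i = 3])
  ultimately show ?thesis by simp
qed

lemmas recursive_on_power = recursive_on_op2[OF computable2_swap[OF computable2_power]]

lemma computable2_pred: "computable2 (\<lambda>a b. a - 1)"
proof -
  have "rec_nat 0 (\<lambda>m c. m) a = a - 1" for a :: nat
    by (cases a) auto
  moreover have "computable2 (\<lambda>a b. rec_nat 0 (\<lambda>m c. m) a)"
    by (rule computable2_rec[where f = "\<lambda>b. 0" and g = "\<lambda>m c b. m"], rule recursive_on_const)
      (auto intro: recursive_on_proj[where i = 0])
  ultimately show ?thesis by simp
qed

lemma computable2_diff: "computable2 (\<lambda>a b. b - a)"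
proof -
  have "rec_nat b (\<lambda>m c. c - 1) a = b - a" for a b :: nat
    by (induction a) auto
  moreover have "computable2 (\<lambda>a b. rec_nat b (\<lambda>m c. c - 1) a)"
    by (rule computable2_rec[where f = "\<lambda>b. b" and g = "\<lambda>m c b. c - 1"])
      (rule recursive_on_proj[where i = 1], simp, rule recursive_on_op2[OF computable2_pred],
        (rule recursive_on_proj[where i = 1], simp)+)
  ultimately show ?thesis by simp
qed

lemmas recursive_on_diff = recursive_on_op2[OF computable2_swap[OF computable2_diff]]

lemma recursive_on_le:
  assumes "recursive_on D x a" "recursive_on D x b"
  shows "recursive_on D x (\<lambda>s. of_bool (a s \<le> b s))"
  by (rule recursive_on_cong[where h = "\<lambda>s. 1 - (a s - b s)"])
    (auto intro!: recursive_on_diff recursive_on_const assms)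

lemma recursive_on_not:
  assumes "recursive_on D x (\<lambda>s. of_bool (P s))"
  shows "recursive_on D x (\<lambda>s. of_bool (\<not> P s))"
  by (rule recursive_on_cong[where h = "\<lambda>s. 1 - of_bool (P s)"])
    (auto intro!: recursive_on_diff recursive_on_const assms)

lemma recursive_on_conj:
  assumes "recursive_on D x (\<lambda>s. of_bool (P s))" "recursive_on D x (\<lambda>s. of_bool (Q s))"
  shows "recursive_on D x (\<lambda>s. of_bool (P s \<and> Q s))"
  by (rule recursive_on_cong[where h = "\<lambda>s. of_bool (P s) * of_bool (Q s)"])
    (auto intro!: recursive_on_mult assms)

lemma recursive_on_disj:
  assumes "recursive_on D x (\<lambda>s. of_bool (P s))" "recursive_on D x (\<lambda>s. of_bool (Q s))"
  shows "recursive_on D x (\<lambda>s. of_bool (P s \<or> Q s))"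
  using recursive_on_not[OF recursive_on_conj[OF assms[THEN recursive_on_not]]] by simp

lemma recursive_on_Bex:
  assumes "finite M" "\<And>i. i \<in> M \<Longrightarrow> recursive_on D x (\<lambda>s. of_bool (P i s))"
  shows "recursive_on D x (\<lambda>s. of_bool (\<exists>i\<in>M. P i s))"
  using assms
proof (induction M rule: finite_induct)
  case empty
  show ?case by (simp add: recursive_on_const)
next
  case (insert i M)
  then show ?case using recursive_on_disj[of D x "P i" "\<lambda>s. \<exists>i\<in>M. P i s"] by simp
qed

lemma recursive_on_eq:
  assumes "recursive_on D x a" "recursive_on D x b"
  shows "recursive_on D x (\<lambda>s. of_bool (a s = b s))"
  by (rule recursive_on_cong[where h = "\<lambda>s. of_bool (a s \<le> b s \<and> b s \<le> a s)"])
    (auto intro!: recursive_on_conj recursive_on_le assms)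

lemma recursive_on_if:
  assumes "recursive_on D x (\<lambda>s. of_bool (P s))" "recursive_on D x a" "recursive_on D x b"
  shows "recursive_on D x (\<lambda>s. if P s then a s else b s)"
  by (rule recursive_on_cong[where h = "\<lambda>s. of_bool (P s) * a s + of_bool (\<not> P s) * b s"])
    (auto intro!: recursive_on_add recursive_on_mult recursive_on_not assms)

text \<open>
  The quotient of \<open>m\<close> by \<open>d\<close> is the least \<open>n\<close> with \<open>m < (n + 1) d\<close>.
\<close>

lemma recursive_on_div:
  assumes a: "recursive_on D x a" and b: "recursive_on D x b" and pos: "\<And>s. s \<in> D \<Longrightarrow> b s > 0"
  shows "recursive_on D x (\<lambda>s. a s div b s)"
proof -
  have div: "(LEAST n. Suc m \<le> Suc n * d) = m div d" if "d > 0" for m d :: nat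
  proof (rule Least_equality)
    show "Suc m \<le> Suc (m div d) * d"
      using that dividend_less_div_times[of d m] by (simp add: Suc_le_eq)
    show "m div d \<le> n" if "Suc m \<le> Suc n * d" for n
      using that \<open>d > 0\<close> by (metis Suc_le_eq less_Suc_eq_le less_mult_imp_div_less)
  qed
  have "recursive_on {t. snd t > 0} (\<lambda>t. [fst t, snd t])
          (\<lambda>t. LEAST n. Suc (fst t) \<le> Suc n * snd t)"
  proof (rule recursive_on_Least[where E = UNIV])
    show "recursive_on UNIV (\<lambda>t. fst t # [fst (snd t), snd (snd t)])
        (\<lambda>t. of_bool (\<not> Suc (fst (snd t)) \<le> Suc (fst t) * snd (snd t)))"
      by (intro recursive_on_not recursive_on_le recursive_on_mult recursive_on_Suc)
        (auto intro: recursive_on_proj[where i = 0] recursive_on_proj[where i = 1]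
            recursive_on_proj[where i = 2])
    show "\<exists>n. Suc (fst s) \<le> Suc n * snd s" if "s \<in> {t. snd t > 0}" for s :: "nat \<times> nat"
      using that by (intro exI[of _ "fst s"]) (cases "snd s", auto)
  qed auto
  from recursive_on_compose[OF this, of "[a, b]" D x "\<lambda>s. (a s, b s)"]
  have "recursive_on D x (\<lambda>s. LEAST n. Suc (a s) \<le> Suc n * b s)"
    using a b pos by auto
  then show ?thesis by (rule recursive_on_cong) (use div pos in auto)
qed

lemma recursive_on_mod:
  assumes a: "recursive_on D x a" and b: "recursive_on D x b" and pos: "\<And>s. s \<in> D \<Longrightarrow> b s > 0"
  shows "recursive_on D x (\<lambda>s. a s mod b s)"
  by (rule recursive_on_cong[where h = "\<lambda>s. a s - a s div b s * b s"])
    (intro recursive_on_diff recursive_on_mult recursive_on_div assms, auto simp: minus_div_mult_eq_mod)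

text \<open>
  Coding of pairs: \<open>(a + b)\<^sup>2 \<le> pair_code a b < (a + b + 1)\<^sup>2\<close>, so \<open>a + b\<close> is the integer square
  root of the code, and minimization can find it.
\<close>

definition pair_code :: "nat \<Rightarrow> nat \<Rightarrow> nat" where
  "pair_code a b = (a + b) * (a + b) + a"

definition pair_sum :: "nat \<Rightarrow> nat" where
  "pair_sum z = (LEAST s. Suc z \<le> Suc s * Suc s)"

definition pair_fst :: "nat \<Rightarrow> nat" where
  "pair_fst z = z - pair_sum z * pair_sum z"

definition pair_snd :: "nat \<Rightarrow> nat" where
  "pair_snd z = pair_sum z - pair_fst z"

lemma pair_sum_pair_code: "pair_sum (pair_code a b) = a + b"
  unfolding pair_sum_def
proof (rule Least_equality)
  show "Suc (pair_code a b) \<le> Suc (a + b) * Suc (a + b)"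
    by (simp add: pair_code_def)
  fix s assume "Suc (pair_code a b) \<le> Suc s * Suc s"
  then have "(a + b) * (a + b) < Suc s * Suc s" by (simp add: pair_code_def)
  then have "(a + b)\<^sup>2 < (Suc s)\<^sup>2" by (simp add: power2_eq_square)
  then have "a + b < Suc s" using power2_less_imp_less by blast
  then show "a + b \<le> s" by simp
qed

lemma pair_fst_pair_code [simp]: "pair_fst (pair_code a b) = a"
  unfolding pair_fst_def pair_sum_pair_code by (simp add: pair_code_def)

lemma pair_snd_pair_code [simp]: "pair_snd (pair_code a b) = b"
  by (simp add: pair_snd_def pair_sum_pair_code)

lemma recursive_on_pair_code:
  assumes "recursive_on D x a" "recursive_on D x b"
  shows "recursive_on D x (\<lambda>s. pair_code (a s) (b s))"
  unfolding pair_code_def by (intro recursive_on_add recursive_on_mult assms)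

lemma recursive_on_pair_sum:
  assumes "recursive_on D x a"
  shows "recursive_on D x (\<lambda>s. pair_sum (a s))"
proof -
  have "recursive_on UNIV (\<lambda>z. [z]) (\<lambda>z. LEAST s. Suc z \<le> Suc s * Suc s)"
  proof (rule recursive_on_Least[where E = UNIV])
    show "recursive_on UNIV (\<lambda>t. fst t # [snd t])
        (\<lambda>t. of_bool (\<not> Suc (snd t) \<le> Suc (fst t) * Suc (fst t)))"
      by (intro recursive_on_not recursive_on_le recursive_on_mult recursive_on_Suc)
        (auto intro: recursive_on_proj[where i = 0] recursive_on_proj[where i = 1])
    show "\<exists>n. Suc s \<le> Suc n * Suc n" for s by (rule exI[of _ s]) simp
  qed auto
  from recursive_on_compose[OF this, of "[a]" D x a] show ?thesis
    using assms by (simp add: pair_sum_def)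
qed

lemma recursive_on_pair_fst:
  assumes "recursive_on D x a"
  shows "recursive_on D x (\<lambda>s. pair_fst (a s))"
  unfolding pair_fst_def by (intro recursive_on_diff recursive_on_mult recursive_on_pair_sum assms)

lemma recursive_on_pair_snd:
  assumes "recursive_on D x a"
  shows "recursive_on D x (\<lambda>s. pair_snd (a s))"
  unfolding pair_snd_def
  by (intro recursive_on_diff recursive_on_pair_sum recursive_on_pair_fst assms)

section \<open>Codes of finite sets\<close>

lemma recursive_on_insert:
  assumes q: "natural_enumeration q"
    and w: "recursive_on D x (\<lambda>s. q (w s))" and u: "recursive_on D x u"
    and fin: "\<And>s. s \<in> D \<Longrightarrow> finite (w s)"
  shows "recursive_on D x (\<lambda>s. q (insert (u s) (w s)))"
proof -
  obtain p where "\<And>w u. finite w \<Longrightarrow> recf_eval p [q w, u] = Some (q (w \<union> {u}))"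
    using q unfolding natural_enumeration_def by blast
  then have "recursive_on {t. finite (fst t)} (\<lambda>t. [q (fst t), snd t]) (\<lambda>t. q (insert (snd t) (fst t)))"
    unfolding recursive_on_def by (intro exI[of _ p]) simp
  from recursive_on_compose[OF this, of "[\<lambda>s. q (w s), u]" D x "\<lambda>s. (w s, u s)"] show ?thesis
    using w u fin by auto
qed

text \<open>
  The code of a finite set need not be decoded: \<open>u\<close> lies in \<open>w\<close> exactly if inserting it leaves the
  code unchanged, because the coding is injective.
\<close>

lemma recursive_on_member:
  assumes q: "natural_enumeration q"
    and w: "recursive_on D x (\<lambda>s. q (w s))" and u: "recursive_on D x u"
    and fin: "\<And>s. s \<in> D \<Longrightarrow> finite (w s)"
  shows "recursive_on D x (\<lambda>s. of_bool (u s \<in> w s))"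
proof (rule recursive_on_cong)
  show "recursive_on D x (\<lambda>s. of_bool (q (insert (u s) (w s)) = q (w s)))"
    by (intro recursive_on_eq recursive_on_insert assms)
  fix s assume "s \<in> D"
  then have "q (insert (u s) (w s)) = q (w s) \<longleftrightarrow> insert (u s) (w s) = w s"
    using q fin unfolding natural_enumeration_def
    by (metis finite.insertI inj_onD mem_Collect_eq)
  then show "of_bool (q (insert (u s) (w s)) = q (w s)) = of_bool (u s \<in> w s)"
    by (simp add: insert_absorb2 insert_eq_iff) blast
qed


section \<open>Exploring a finite set\<close>

text \<open>
  A state holds the vertices accepted and the vertices rejected so far.
\<close>

type_synonym state = "nat set \<times> nat set"

text \<open>
  The graph enters only through the maps \<open>\<phi> \<in> \<Phi>\<close>, which lead from a vertex \<open>v\<close> to its neighbours; in a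
  Cayley graph they are the left multiplications by the generators.
\<close>

definition frontier :: "(nat \<Rightarrow> nat) set \<Rightarrow> state \<Rightarrow> nat set" where
  "frontier \<Phi> \<sigma> = {v. v \<notin> fst \<sigma> \<and> v \<notin> snd \<sigma> \<and> (\<exists>\<phi>\<in>\<Phi>. \<phi> v \<in> fst \<sigma>)}"

definition candidate :: "(nat \<Rightarrow> nat) set \<Rightarrow> state \<Rightarrow> nat" where
  "candidate \<Phi> \<sigma> = (LEAST v. v \<in> frontier \<Phi> \<sigma>)"

definition step :: "(nat \<Rightarrow> nat) set \<Rightarrow> bool \<Rightarrow> state \<Rightarrow> state" where
  "step \<Phi> b \<sigma> = (if b then (insert (candidate \<Phi> \<sigma>) (fst \<sigma>), snd \<sigma>)
                          else (fst \<sigma>, insert (candidate \<Phi> \<sigma>) (snd \<sigma>)))"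

text \<open>
  The conditions under which the search for the candidate terminates.
\<close>

definition ready :: "(nat \<Rightarrow> nat) set \<Rightarrow> state \<Rightarrow> bool" where
  "ready \<Phi> \<sigma> \<longleftrightarrow> finite (fst \<sigma>) \<and> finite (snd \<sigma>) \<and> frontier \<Phi> \<sigma> \<noteq> {}"

fun legal :: "(nat \<Rightarrow> nat) set \<Rightarrow> bool list \<Rightarrow> state \<Rightarrow> bool" where
  "legal \<Phi> [] \<sigma> = True"
| "legal \<Phi> (b # bs) \<sigma> = (ready \<Phi> \<sigma> \<and> legal \<Phi> bs (step \<Phi> b \<sigma>))"

lemma legal_append: "legal \<Phi> (bs @ cs) \<sigma> \<longleftrightarrow> legal \<Phi> bs \<sigma> \<and> legal \<Phi> cs (fold (step \<Phi>) bs \<sigma>)"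
  by (induction bs arbitrary: \<sigma>) auto

lemma candidate_in_frontier: "frontier \<Phi> \<sigma> \<noteq> {} \<Longrightarrow> candidate \<Phi> \<sigma> \<in> frontier \<Phi> \<sigma>"
  unfolding candidate_def by (metis LeastI ex_in_conv)

text \<open>
  Accept a candidate exactly if it belongs to \<open>F\<close>.  The candidate always exists while \<open>A \<noteq> F\<close>, by
  \<open>exit\<close>, which expresses that \<open>F\<close> is connected; an accepted candidate enlarges \<open>A\<close> within \<open>F\<close>, and a
  rejected one is a neighbour of \<open>F\<close> outside \<open>F\<close>, thus enlarges \<open>R\<close> within \<open>B\<close>.  So the number of
  decisions is at most \<open>card F + card B\<close>, and only \<open>card B\<close> of them are rejections.
\<close>

lemma exists_exploration:
  assumes F: "finite F" and B: "finite B"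
    and exit: "\<And>A. A \<subset> F \<Longrightarrow> r \<in> A \<Longrightarrow> \<exists>v\<in>F - A. \<exists>\<phi>\<in>\<Phi>. \<phi> v \<in> A"
    and boundary: "\<And>v \<phi>. \<phi> \<in> \<Phi> \<Longrightarrow> \<phi> v \<in> F \<Longrightarrow> v \<notin> F \<Longrightarrow> v \<in> B"
    and "A \<subseteq> F" "r \<in> A" "R \<subseteq> B - F"
  shows "\<exists>bs. legal \<Phi> bs (A, R) \<and> fst (fold (step \<Phi>) bs (A, R)) = F \<and>
           count_list bs True + card A \<le> card F \<and> count_list bs False + card R \<le> card B"
  using assms(5-7)
proof (induction "card F - card A + (card B - card R)" arbitrary: A R rule: less_induct)
  case less
  have fin: "finite A" "finite R"
    using less.prems(1,3) F B by (meson finite_subset finite_Diff)+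
  have cards: "card A \<le> card F" "card R \<le> card B" using less.prems F B by (auto intro: card_mono)
  show ?case
  proof (cases "A = F")
    case True
    then show ?thesis using cards by (intro exI[of _ "[]"]) auto
  next
    case False
    then have "A \<subset> F" using less.prems by blast
    from exit[OF this less.prems(2)]
    obtain u where "u \<in> F - A" "\<exists>\<phi>\<in>\<Phi>. \<phi> u \<in> A" by blast
    then have "u \<in> frontier \<Phi> (A, R)" using less.prems by (auto simp: frontier_def)
    then have ne: "frontier \<Phi> (A, R) \<noteq> {}" by blast
    define v where "v = candidate \<Phi> (A, R)"
    have v: "v \<notin> A" "v \<notin> R" "\<exists>\<phi>\<in>\<Phi>. \<phi> v \<in> A"
      using candidate_in_frontier[OF ne] by (auto simp: v_def frontier_def)
    have ready: "ready \<Phi> (A, R)" using ne fin by (simp add: ready_def)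
    show ?thesis
    proof (cases "v \<in> F")
      case True
      have sub: "insert v A \<subseteq> F" using True less.prems by blast
      have card: "card (insert v A) = Suc (card A)" using fin v by simp
      have "card (insert v A) \<le> card F" using sub F by (intro card_mono)
      then have "card F - card (insert v A) + (card B - card R)
          < card F - card A + (card B - card R)"
        using card by linarith
      from less.hyps[OF this sub _ less.prems(3)] less.prems(2) obtain bs where "legal \<Phi> bs (insert v A, R)"
        "fst (fold (step \<Phi>) bs (insert v A, R)) = F"
        "count_list bs True + card (insert v A) \<le> card F" "count_list bs False + card R \<le> card B"
        by blast
      then show ?thesis using ready card
        by (intro exI[of _ "True # bs"]) (simp add: step_def v_def)
    next
      case False
      have "v \<in> B" using v(3) False boundary less.prems(1) by (meson subsetD)
      then have sub: "insert v R \<subseteq> B - F" using False less.prems by blast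
      have card: "card (insert v R) = Suc (card R)" using fin v by simp
      have "card (insert v R) \<le> card B" using sub B by (intro card_mono) auto
      then have "card F - card A + (card B - card (insert v R))
          < card F - card A + (card B - card R)"
        using card by linarith
      from less.hyps[OF this less.prems(1,2) sub] obtain bs where "legal \<Phi> bs (A, insert v R)"
        "fst (fold (step \<Phi>) bs (A, insert v R)) = F"
        "count_list bs True + card A \<le> card F" "count_list bs False + card (insert v R) \<le> card B"
        by blast
      then show ?thesis using ready card
        by (intro exI[of _ "False # bs"]) (simp add: step_def v_def)
    qed
  qed
qed


section \<open>Compressing a word with few rejections\<close>

text \<open>
  The digit 1 stands for one acceptance, 2 for one rejection and 3 for \<open>L\<close> acceptances in a row.  The
  digit 0 stands for nothing, so that the infinitely many leading zeros of a number do no harm.  All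
  decisions of one digit are equal, which lets a program carry them out in a simple loop.
\<close>

definition expand :: "nat \<Rightarrow> nat \<Rightarrow> bool list" where
  "expand L d = replicate (if d = 3 then L else of_bool (d \<noteq> 0)) (d \<noteq> 2)"

text \<open>
  A number \<open>k\<close> has at most \<open>k\<close> digits, so reading \<open>k\<close> of them, from the least significant one on,
  reads them all.
\<close>

definition word :: "nat \<Rightarrow> nat \<Rightarrow> bool list" where
  "word L k = concat (map (\<lambda>i. expand L (k div 4 ^ i mod 4)) [0..<k])"

lemma expand_simps [simp]:
  "expand L 0 = []" "expand L 1 = [True]" "expand L (Suc 0) = [True]" "expand L 2 = [False]"
  "expand L 3 = replicate L True"
  by (auto simp: expand_def)

text \<open>
  Take \<open>ds\<close> as base 4 digits, the first one least significant.  As they are nonzero, the number \<open>k\<close>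
  that they form is at least \<open>length ds\<close>, so \<open>word\<close>, which reads \<open>k\<close> digits, misses none of them.
\<close>

lemma exists_number_with_digits:
  assumes "set ds \<subseteq> {1, 2, 3}"
  shows "\<exists>k<4 ^ length ds. word L k = concat (map (expand L) ds)"
proof -
  have "\<exists>k. k < 4 ^ length ds \<and> length ds \<le> k \<and>
          (\<forall>i. k div 4 ^ i mod 4 = (if i < length ds then ds ! i else 0))"
    using assms
  proof (induction ds)
    case Nil
    show ?case by auto
  next
    case (Cons d ds)
    then obtain k where k: "k < 4 ^ length ds" "length ds \<le> k"
      "\<And>i. k div 4 ^ i mod 4 = (if i < length ds then ds ! i else 0)"
      by auto
    have d: "1 \<le> d" "d < 4" using Cons.prems by auto
    have "(d + 4 * k) div 4 ^ i mod 4 = (if i < length (d # ds) then (d # ds) ! i else 0)" for i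
    proof (cases i)
      case 0
      then show ?thesis using d by simp
    next
      case (Suc j)
      have "(d + 4 * k) div 4 ^ Suc j = k div 4 ^ j"
        using d by (simp add: div_mult2_eq)
      then show ?thesis using Suc k(3)[of j] by simp
    qed
    moreover have "d + 4 * k < 4 ^ length (d # ds)" using k(1) d by simp
    moreover have "length (d # ds) \<le> d + 4 * k" using k(2) d by simp
    ultimately show ?case by blast
  qed
  then obtain k where k: "k < 4 ^ length ds" "length ds \<le> k"
    "\<And>i. k div 4 ^ i mod 4 = (if i < length ds then ds ! i else 0)"
    by blast
  have "[0..<k] = [0..<length ds] @ [length ds..<k]"
    using k(2) by (metis le_add_diff_inverse upt_add_eq_append zero_le)
  moreover have "map (\<lambda>i. expand L (k div 4 ^ i mod 4)) [0..<length ds] = map (expand L) ds"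
    by (rule nth_equalityI) (auto simp: k(3))
  moreover have "concat (map (\<lambda>i. expand L (k div 4 ^ i mod 4)) [length ds..<k]) = []"
    by (auto simp: k(3))
  ultimately have "word L k = concat (map (expand L) ds)"
    by (simp add: word_def)
  then show ?thesis using k(1) by blast
qed

text \<open>
  Division with remainder: \<open>a div L\<close> digits 3 and fewer than \<open>L\<close> digits 1.
\<close>

lemma run_compression:
  assumes "L > 0"
  shows "\<exists>ds. set ds \<subseteq> {1, 2, 3} \<and> concat (map (expand L) ds) = replicate a True \<and>
           L * length ds \<le> a + L * L"
proof -
  define ds where "ds = replicate (a div L) 3 @ replicate (a mod L) (1::nat)"
  have "concat (map (expand L) ds) = replicate (a div L * L) True @ replicate (a mod L) True"
  proof -
    have "concat (replicate m (replicate L True)) = replicate (m * L) True" for m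
      by (induction m) (auto simp: replicate_add)
    moreover have "concat (replicate m [True]) = replicate m True" for m
      by (induction m) auto
    ultimately show ?thesis by (simp add: ds_def)
  qed
  also have "\<dots> = replicate a True" by (simp flip: replicate_add)
  finally have "concat (map (expand L) ds) = replicate a True" .
  moreover have "L * length ds \<le> a + L * L"
  proof -
    have "L * (a mod L) \<le> L * L"
      using assms by (intro mult_left_mono) (auto simp: less_imp_le)
    with times_div_less_eq_dividend have "L * (a div L) + L * (a mod L) \<le> a + L * L"
      by (rule add_mono)
    then show ?thesis by (simp add: ds_def distrib_left)
  qed
  moreover have "set ds \<subseteq> {1, 2, 3}" by (auto simp: ds_def)
  ultimately show ?thesis by blast
qed

text \<open>
  The rejections cut the word into \<open>Suc (count_list bs False)\<close> runs of acceptances.  A run of length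
  \<open>a\<close> costs at most \<open>a / L + L\<close> digits and a rejection costs one more, so for a
  long word with few rejections the number of digits is about \<open>1 / L\<close> times the length of the word.
\<close>

lemma word_compression:
  assumes "L > 0"
  shows "\<exists>ds. set ds \<subseteq> {1, 2, 3} \<and> concat (map (expand L) ds) = bs \<and>
           L * length ds \<le> count_list bs True + (L * L + L) * Suc (count_list bs False)"
proof (induction bs rule: length_induct)
  case (1 bs)
  define a where "a = length (takeWhile id bs)"
  have run: "takeWhile id bs = replicate a True"
    unfolding a_def by (rule replicate_eqI) (auto dest: set_takeWhileD)
  obtain ds where ds: "set ds \<subseteq> {1, 2, 3}" "concat (map (expand L) ds) = replicate a True"
    "L * length ds \<le> a + L * L"
    using run_compression[OF assms] by blast
  have cnt: "count_list (replicate a True) True = a" "count_list (replicate a True) False = 0"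
    by (induction a) auto
  show ?case
  proof (cases "dropWhile id bs")
    case Nil
    have "bs = takeWhile id bs @ dropWhile id bs" by (rule takeWhile_dropWhile_id[symmetric])
    also have "\<dots> = replicate a True" by (simp only: run Nil append_Nil2)
    finally have "bs = replicate a True" .
    then show ?thesis using ds cnt by (intro exI[of _ ds]) auto
  next
    case (Cons b cs)
    then have "\<not> b" using hd_dropWhile[of id bs] by simp
    then have bs: "bs = replicate a True @ False # cs"
      using run Cons takeWhile_dropWhile_id[of id bs] by simp
    then have "length cs < length bs" by simp
    then obtain es where es: "set es \<subseteq> {1, 2, 3}" "concat (map (expand L) es) = cs"
      "L * length es \<le> count_list cs True + (L * L + L) * Suc (count_list cs False)"
      using 1 by blast
    have "L * length (ds @ 2 # es) = L * length ds + L * length es + L"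
      by (simp add: algebra_simps)
    also have "\<dots> \<le> count_list bs True + (L * L + L) * Suc (count_list bs False)"
      using ds(3) es(3) cnt by (simp add: bs)
    finally show ?thesis using ds es bs
      by (intro exI[of _ "ds @ 2 # es"]) auto
  qed
qed
section \<open>The decoder\<close>

definition state_code :: "(nat set \<Rightarrow> nat) \<Rightarrow> state \<Rightarrow> nat" where
  "state_code q \<sigma> = pair_code (q (fst \<sigma>)) (q (snd \<sigma>))"

lemma recursive_on_fst_state:
  "recursive_on D x (\<lambda>s. state_code q (\<sigma> s)) \<Longrightarrow> recursive_on D x (\<lambda>s. q (fst (\<sigma> s)))"
  by (drule recursive_on_pair_fst) (simp add: state_code_def)

lemma recursive_on_snd_state:
  "recursive_on D x (\<lambda>s. state_code q (\<sigma> s)) \<Longrightarrow> recursive_on D x (\<lambda>s. q (snd (\<sigma> s)))"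
  by (drule recursive_on_pair_snd) (simp add: state_code_def)

text \<open>
  Minimization over \<open>v\<close>: as \<open>\<Phi>\<close> is finite, \<open>v \<in> frontier \<Phi> \<sigma>\<close> is a finite boolean combination of
  membership tests in the two sets of the state.
\<close>

lemma recursive_on_candidate:
  assumes q: "natural_enumeration q"
    and \<Phi>: "finite \<Phi>" "\<And>\<phi>. \<phi> \<in> \<Phi> \<Longrightarrow> recursive_on UNIV (\<lambda>v. [v]) \<phi>"
  shows "recursive_on (Collect (ready \<Phi>)) (\<lambda>\<sigma>. [state_code q \<sigma>]) (candidate \<Phi>)"
proof -
  have "recursive_on (Collect (ready \<Phi>)) (\<lambda>\<sigma>. [state_code q \<sigma>])
          (\<lambda>\<sigma>. LEAST v. v \<in> frontier \<Phi> \<sigma>)"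
  proof (rule recursive_on_Least[where E = "UNIV \<times> Collect (ready \<Phi>)"])
    let ?D = "(UNIV :: nat set) \<times> Collect (ready \<Phi>)"
    let ?x = "\<lambda>t. fst t # [state_code q (snd t)]"
    have v: "recursive_on ?D ?x fst"
      by (rule recursive_on_proj[where i = 0]) simp
    have \<sigma>: "recursive_on ?D ?x (\<lambda>t. state_code q (snd t))"
      by (rule recursive_on_proj[where i = 1]) simp
    have move: "recursive_on ?D ?x (\<lambda>t. \<phi> (fst t))" if "\<phi> \<in> \<Phi>" for \<phi>
      by (rule recursive_on_compose[OF \<Phi>(2)[OF that], of "[fst]"]) (use v in auto)
    have "recursive_on ?D ?x (\<lambda>t. of_bool (fst t \<notin> fst (snd t) \<and> fst t \<notin> snd (snd t) \<and>
            (\<exists>\<phi>\<in>\<Phi>. \<phi> (fst t) \<in> fst (snd t))))"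
      by (intro recursive_on_conj recursive_on_not recursive_on_Bex[OF \<Phi>(1)] v move
          recursive_on_member[OF q] recursive_on_fst_state[OF \<sigma>] recursive_on_snd_state[OF \<sigma>])
        (auto simp: ready_def)
    then show "recursive_on ?D ?x (\<lambda>t. of_bool (fst t \<notin> frontier \<Phi> (snd t)))"
      by (intro recursive_on_not) (simp add: frontier_def)
  qed (auto simp: ready_def)
  moreover have "(\<lambda>\<sigma>. LEAST v. v \<in> frontier \<Phi> \<sigma>) = candidate \<Phi>"
    by (simp add: candidate_def fun_eq_iff)
  ultimately show ?thesis by simp
qed

lemma recursive_on_step:
  assumes q: "natural_enumeration q"
    and \<Phi>: "finite \<Phi>" "\<And>\<phi>. \<phi> \<in> \<Phi> \<Longrightarrow> recursive_on UNIV (\<lambda>v. [v]) \<phi>"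
    and b: "recursive_on D x (\<lambda>s. of_bool (b s))"
    and \<sigma>: "recursive_on D x (\<lambda>s. state_code q (\<sigma> s))"
    and ready: "\<And>s. s \<in> D \<Longrightarrow> ready \<Phi> (\<sigma> s)"
  shows "recursive_on D x (\<lambda>s. state_code q (step \<Phi> (b s) (\<sigma> s)))"
proof -
  have v: "recursive_on D x (\<lambda>s. candidate \<Phi> (\<sigma> s))"
    by (rule recursive_on_compose[OF recursive_on_candidate[OF q \<Phi>], of "[\<lambda>s. state_code q (\<sigma> s)]"])
      (use \<sigma> ready in auto)
  have "recursive_on D x (\<lambda>s. pair_code
          (if b s then q (insert (candidate \<Phi> (\<sigma> s)) (fst (\<sigma> s))) else q (fst (\<sigma> s)))
          (if b s then q (snd (\<sigma> s)) else q (insert (candidate \<Phi> (\<sigma> s)) (snd (\<sigma> s)))))"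
    by (intro recursive_on_pair_code recursive_on_if b recursive_on_insert[OF q] v
        recursive_on_fst_state[OF \<sigma>] recursive_on_snd_state[OF \<sigma>])
      (use ready in \<open>auto simp: ready_def\<close>)
  then show ?thesis
    by (rule recursive_on_cong) (simp add: state_code_def step_def)
qed

text \<open>
  The inner loop of the decoder: a digit is carried out by repeating one step.
\<close>

lemma recursive_on_expand:
  assumes q: "natural_enumeration q"
    and \<Phi>: "finite \<Phi>" "\<And>\<phi>. \<phi> \<in> \<Phi> \<Longrightarrow> recursive_on UNIV (\<lambda>v. [v]) \<phi>"
  shows "recursive_on {t. legal \<Phi> (expand L (fst t)) (snd t)} (\<lambda>t. [fst t, state_code q (snd t)])
           (\<lambda>t. state_code q (fold (step \<Phi>) (expand L (fst t)) (snd t)))"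
proof -
  let ?D = "{t. legal \<Phi> (expand L (fst t)) (snd t)}"
  let ?x = "\<lambda>t. [fst t, state_code q (snd t)]"
  let ?reps = "\<lambda>d. if d = 3 then L else of_bool (d \<noteq> 0)"
  have iterate: "rec_nat \<sigma> (\<lambda>_. step \<Phi> b) n = fold (step \<Phi>) (replicate n b) \<sigma>" for \<sigma> b n
  proof (induction n)
    case (Suc n)
    then show ?case by (simp add: replicate_append_same[symmetric] del: replicate.simps(2))
  qed simp
  have "recursive_on ?D ?x (\<lambda>t. state_code q
          (rec_nat (snd t) (\<lambda>m c. step \<Phi> (fst t \<noteq> 2) c) (?reps (fst t))))"
  proof (rule recursive_on_rec[where k = 2 and E = "{u. ready \<Phi> (fst (snd u))}"])
    have d: "recursive_on ?D ?x fst" by (rule recursive_on_proj[where i = 0]) simp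
    show "recursive_on ?D ?x (\<lambda>t. state_code q (snd t))"
      by (rule recursive_on_proj[where i = 1]) simp
    show "recursive_on ?D ?x (\<lambda>t. ?reps (fst t))"
      by (intro recursive_on_if recursive_on_eq recursive_on_not recursive_on_const d)
    \<comment> \<open>The loop meets only states at which the digit still has decisions to carry out.\<close>
    show "recursive_on {u. ready \<Phi> (fst (snd u))}
        (\<lambda>t. fst t # state_code q (fst (snd t)) # [fst (snd (snd t)), state_code q (snd (snd (snd t)))])
        (\<lambda>t. state_code q (step \<Phi> (fst (snd (snd t)) \<noteq> 2) (fst (snd t))))"
      by (intro recursive_on_step[OF q \<Phi>] recursive_on_not recursive_on_eq recursive_on_const)
        (auto intro: recursive_on_proj[where i = 1] recursive_on_proj[where i = 2])
    fix t m assume "t \<in> ?D" and m: "m < ?reps (fst t)"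
    then have "legal \<Phi> (replicate (?reps (fst t)) (fst t \<noteq> 2)) (snd t)"
      by (simp add: expand_def)
    moreover obtain j where "?reps (fst t) = m + Suc j"
      using m less_imp_Suc_add by fastforce
    ultimately have "ready \<Phi> (fold (step \<Phi>) (replicate m (fst t \<noteq> 2)) (snd t))"
      by (simp only: replicate_add legal_append replicate.simps legal.simps)
    then show "(m, rec_nat (snd t) (\<lambda>m c. step \<Phi> (fst t \<noteq> 2) c) m, t)
        \<in> {u. ready \<Phi> (fst (snd u))}"
      by (simp add: iterate)
  qed auto
  then show ?thesis
    by (rule recursive_on_cong) (simp add: iterate expand_def)
qed

text \<open>
  The outer loop of the decoder runs through the digits of \<open>k\<close>; at the end the rejected vertices are
  forgotten.
\<close>

lemma recursive_on_decode:
  assumes q: "natural_enumeration q"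
    and \<Phi>: "finite \<Phi>" "\<And>\<phi>. \<phi> \<in> \<Phi> \<Longrightarrow> recursive_on UNIV (\<lambda>v. [v]) \<phi>"
  shows "recursive_on {k. legal \<Phi> (word L k) \<sigma>} (\<lambda>k. [k])
           (\<lambda>k. q (fst (fold (step \<Phi>) (word L k) \<sigma>)))"
proof -
  let ?D = "{k. legal \<Phi> (word L k) \<sigma>}"
  let ?digit = "\<lambda>k i. k div 4 ^ i mod 4 :: nat"
  let ?prefix = "\<lambda>k m. concat (map (\<lambda>i. expand L (?digit k i)) [0..<m])"
  let ?E = "{u. legal \<Phi> (expand L (?digit (snd (snd u)) (fst u))) (fst (snd u))}"
  let ?y = "\<lambda>u. fst u # state_code q (fst (snd u)) # [snd (snd u)]"
  have iterate: "rec_nat \<sigma> (\<lambda>i c. fold (step \<Phi>) (expand L (?digit k i)) c) m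
      = fold (step \<Phi>) (?prefix k m) \<sigma>" for k m
    by (induction m) auto
  have "recursive_on ?D (\<lambda>k. [k])
          (\<lambda>k. state_code q (rec_nat \<sigma> (\<lambda>i c. fold (step \<Phi>) (expand L (?digit k i)) c) k))"
  proof (rule recursive_on_rec[where k = 1 and E = ?E])
    show "recursive_on ?D (\<lambda>k. [k]) (\<lambda>k. k)" by (rule recursive_on_proj[where i = 0]) simp
    have digit: "recursive_on ?E ?y (\<lambda>u. ?digit (snd (snd u)) (fst u))"
      by (intro recursive_on_mod recursive_on_div recursive_on_power recursive_on_const)
        (auto intro: recursive_on_proj[where i = 0] recursive_on_proj[where i = 2])
    have state: "recursive_on ?E ?y (\<lambda>u. state_code q (fst (snd u)))"
      by (rule recursive_on_proj[where i = 1]) simp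
    show "recursive_on ?E ?y
        (\<lambda>u. state_code q (fold (step \<Phi>) (expand L (?digit (snd (snd u)) (fst u))) (fst (snd u))))"
      using recursive_on_compose[OF recursive_on_expand[OF q \<Phi>, of L],
          of "[\<lambda>u. ?digit (snd (snd u)) (fst u), \<lambda>u. state_code q (fst (snd u))]" ?E ?y
            "\<lambda>u. (?digit (snd (snd u)) (fst u), fst (snd u))"]
        digit state
      by auto
    fix k m assume "k \<in> ?D" and m: "m < k"
    have "[0..<k] = [0..<m] @ m # [Suc m..<k]"
      using m by (metis le_add_diff_inverse less_imp_le upt_add_eq_append upt_conv_Cons zero_le)
    then have "word L k = ?prefix k m @ expand L (?digit k m) @
        concat (map (\<lambda>i. expand L (?digit k i)) [Suc m..<k])"
      by (simp add: word_def)
    then have "legal \<Phi> (expand L (?digit k m)) (fold (step \<Phi>) (?prefix k m) \<sigma>)"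
      using \<open>k \<in> ?D\<close> by (simp add: legal_append)
    then show "(m, rec_nat \<sigma> (\<lambda>i c. fold (step \<Phi>) (expand L (?digit k i)) c) m, k) \<in> ?E"
      by (simp add: iterate)
  qed (auto intro: recursive_on_const)
  then have "recursive_on ?D (\<lambda>k. [k]) (\<lambda>k. state_code q (fold (step \<Phi>) (word L k) \<sigma>))"
    by (simp only: iterate flip: word_def)
  then show ?thesis by (rule recursive_on_fst_state)
qed


section \<open>Complexity of connected sets\<close>

text \<open>
  A program \<open>p\<close>, read as a decompressor of strings, competes with the optimal one: a string of length
  at most \<open>l\<close> describes \<open>n\<close> if \<open>p\<close> computes \<open>n\<close> from a number below \<open>2 ^ l\<close>.
\<close>

lemma optimal_upper_bound:
  assumes "optimal f"
  obtains K where "\<And>k n l. recf_eval p [k] = Some n \<Longrightarrow> k < 2 ^ l \<Longrightarrow>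
                     the_enat (nat_complexity f n) \<le> l + K"
proof -
  define f' where "f' = (\<lambda>y. map_option str_of_index (recf_eval p [str_index y]))"
  have inverse: "str_index (str_of_index n) = n" for n
    unfolding str_of_index_def using bij_str_index by (simp add: bij_is_surj surj_f_inv_f)
  have "partial_computable f'"
    unfolding partial_computable_def f'_def
    by (intro exI[of _ p]) (simp add: option.map_comp comp_def inverse option.map_ident)
  then obtain K where K: "\<And>x. complexity f x < complexity f' x + enat K"
    using assms unfolding optimal_def by blast
  have "the_enat (nat_complexity f n) \<le> l + K" if "recf_eval p [k] = Some n" "k < 2 ^ l" for k n l
  proof -
    let ?y = "str_of_index k"
    have "f' ?y = Some (str_of_index n)" by (simp add: f'_def inverse that)
    then have "complexity f' (str_of_index n) \<le> enat (length ?y)"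
      unfolding complexity_def by (intro INF_lower) simp
    then have "nat_complexity f n < enat (length ?y) + enat K"
      unfolding nat_complexity_def using K order_less_le_trans add_right_mono by blast
    then obtain m where m: "nat_complexity f n = enat m" "m < length ?y + K"
      by (cases "nat_complexity f n") auto
    have "2 ^ length ?y \<le> k + 1" using str_index_bounds(1)[of ?y] by (simp add: inverse)
    also have "\<dots> \<le> 2 ^ l" using that by simp
    finally have "length ?y \<le> l" by simp
    then show ?thesis using m by simp
  qed
  then show ?thesis using that by blast
qed

text \<open>
  For each \<open>L\<close> there is one decoder for all sets.  A digit in base 4 costs two bits, whence the factors 2.
  The bound is multiplied out by \<open>L\<close>; after division by \<open>L\<close> its leading term is \<open>2 / L\<close> times the
  size of the set, and \<open>K\<close>, which depends on \<open>L\<close>, is absorbed as the sets grow.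
\<close>

lemma complexity_of_explorable_set:
  assumes f: "optimal f" and q: "natural_enumeration q"
    and \<Phi>: "finite \<Phi>" "\<And>\<phi>. \<phi> \<in> \<Phi> \<Longrightarrow> recursive_on UNIV (\<lambda>v. [v]) \<phi>"
    and L: "L > 0"
  shows "\<exists>K. \<forall>F B. finite F \<longrightarrow> finite B \<longrightarrow> r \<in> F \<longrightarrow>
       (\<forall>A. A \<subset> F \<longrightarrow> r \<in> A \<longrightarrow> (\<exists>v\<in>F - A. \<exists>\<phi>\<in>\<Phi>. \<phi> v \<in> A)) \<longrightarrow>
       (\<forall>v. v \<notin> F \<longrightarrow> (\<exists>\<phi>\<in>\<Phi>. \<phi> v \<in> F) \<longrightarrow> v \<in> B) \<longrightarrow>
       L * the_enat (set_complexity f q F) \<le> 2 * card F + 2 * (L * L + L) * Suc (card B) + K"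
proof -
  obtain p where p: "\<And>k. legal \<Phi> (word L k) ({r}, {}) \<Longrightarrow>
      recf_eval p [k] = Some (q (fst (fold (step \<Phi>) (word L k) ({r}, {}))))"
    using recursive_on_decode[OF q \<Phi>] unfolding recursive_on_def by blast
  obtain K where K: "\<And>k n l. recf_eval p [k] = Some n \<Longrightarrow> k < 2 ^ l \<Longrightarrow>
      the_enat (nat_complexity f n) \<le> l + K"
    using optimal_upper_bound[OF f] by blast
  show ?thesis
  proof (intro exI[of _ "L * K"] allI impI)
    fix F B :: "nat set"
    assume F: "finite F" "finite B" "r \<in> F"
      and exit: "\<forall>A. A \<subset> F \<longrightarrow> r \<in> A \<longrightarrow> (\<exists>v\<in>F - A. \<exists>\<phi>\<in>\<Phi>. \<phi> v \<in> A)"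
      and boundary: "\<forall>v. v \<notin> F \<longrightarrow> (\<exists>\<phi>\<in>\<Phi>. \<phi> v \<in> F) \<longrightarrow> v \<in> B"
    have "\<exists>bs. legal \<Phi> bs ({r}, {}) \<and> fst (fold (step \<Phi>) bs ({r}, {})) = F \<and>
        count_list bs True + card {r} \<le> card F \<and> count_list bs False + card ({} :: nat set) \<le> card B"
    proof (rule exists_exploration[OF F(1,2)])
      show "\<exists>v\<in>F - A. \<exists>\<phi>\<in>\<Phi>. \<phi> v \<in> A" if "A \<subset> F" "r \<in> A" for A
        using exit that by meson
      show "v \<in> B" if "\<phi> \<in> \<Phi>" "\<phi> v \<in> F" "v \<notin> F" for v \<phi>
        using boundary that by meson
    qed (use F(3) in simp_all)
    then obtain bs where bs: "legal \<Phi> bs ({r}, {})" "fst (fold (step \<Phi>) bs ({r}, {})) = F"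
      "count_list bs True \<le> card F" "count_list bs False \<le> card B"
      by auto
    obtain ds where ds: "set ds \<subseteq> {1, 2, 3}" "concat (map (expand L) ds) = bs"
      "L * length ds \<le> count_list bs True + (L * L + L) * Suc (count_list bs False)"
      using word_compression[OF L] by blast
    obtain k where k: "k < 4 ^ length ds" "word L k = bs"
      using exists_number_with_digits[OF ds(1)] ds(2) by metis
    have "k < 2 ^ (2 * length ds)" using k(1) by (simp add: power_mult)
    moreover have "recf_eval p [k] = Some (q F)" using p[of k] bs k by simp
    ultimately have "the_enat (set_complexity f q F) \<le> 2 * length ds + K"
      unfolding set_complexity_def using K by blast
    then have "L * the_enat (set_complexity f q F) \<le> L * (2 * length ds + K)"
      by (rule mult_left_mono) simp
    also have "\<dots> = 2 * (L * length ds) + L * K" by (simp add: algebra_simps)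
    also have "\<dots> \<le> 2 * (card F + (L * L + L) * Suc (card B)) + L * K"
    proof -
      have "(L * L + L) * Suc (count_list bs False) \<le> (L * L + L) * Suc (card B)"
        using bs(4) by (intro mult_left_mono) auto
      with bs(3) have "count_list bs True + (L * L + L) * Suc (count_list bs False)
          \<le> card F + (L * L + L) * Suc (card B)"
        by (rule add_mono)
      with ds(3) have "L * length ds \<le> card F + (L * L + L) * Suc (card B)"
        by (rule order_trans)
      then show ?thesis by (intro add_right_mono mult_left_mono) simp_all
    qed
    finally show "L * the_enat (set_complexity f q F)
        \<le> 2 * card F + 2 * (L * L + L) * Suc (card B) + L * K"
      by (simp add: algebra_simps)
  qed
qed


section \<open>Cayley graphs and Folner sequences\<close>

text \<open>
  A path from \<open>r\<close> to a vertex of \<open>F\<close> outside \<open>A\<close> has to leave \<open>A\<close>.  If the arc at which it does so has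
  the form \<open>y = s x\<close> with \<open>x \<in> A\<close>, then the generator leading from \<open>y\<close> back to \<open>x\<close> is the inverse of
  \<open>s\<close>.
\<close>

lemma connected_subset_exit:
  assumes G: "group G" and S: "symmetric_generating_set G S"
    and F: "connected_subset (cayley_graph G S) F" and A: "A \<subset> F" "r \<in> A"
  shows "\<exists>v\<in>F - A. \<exists>s\<in>S. s \<otimes>\<^bsub>G\<^esub> v \<in> A"
proof -
  interpret group G by (rule G)
  let ?E = "arcs_ends (with_proj (mk_symmetric (cayley_graph G S \<restriction> F)))"
  have edge: "x \<in> F \<and> y \<in> F \<and> x \<in> carrier G \<and> y \<in> carrier G \<and>
      ((\<exists>s\<in>S. y = s \<otimes>\<^bsub>G\<^esub> x) \<or> (\<exists>s\<in>S. x = s \<otimes>\<^bsub>G\<^esub> y))" if "(x, y) \<in> ?E" for x y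
    using that S
    by (auto simp: arcs_ends_def arc_to_ends_def mk_symmetric_def induce_subgraph_def
        cayley_graph_def symmetric_generating_set_def)
  obtain u where u: "u \<in> F" "u \<notin> A" using A by blast
  have "r \<in> F" using A by blast
  then have "(r, u) \<in> ?E\<^sup>*"
    using F u unfolding connected_subset_def Digraph_Component.connected_def strongly_connected_def
    by (intro reachable_rtranclI) (auto simp: mk_symmetric_def)
  then have "u \<notin> A \<longrightarrow> (\<exists>x y. (x, y) \<in> ?E \<and> x \<in> A \<and> y \<notin> A)"
  proof (induction rule: rtrancl_induct)
    case base
    show ?case using A by blast
  next
    case (step y z)
    then show ?case by blast
  qed
  then obtain x y where xy: "(x, y) \<in> ?E" "x \<in> A" "y \<notin> A" using u by blast
  have "\<exists>s\<in>S. s \<otimes>\<^bsub>G\<^esub> y = x"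
  proof -
    consider s where "s \<in> S" "y = s \<otimes>\<^bsub>G\<^esub> x" | s where "s \<in> S" "x = s \<otimes>\<^bsub>G\<^esub> y"
      using edge[OF xy(1)] by blast
    then show ?thesis
    proof cases
      case 1
      have "s \<in> carrier G" "x \<in> carrier G"
        using 1 S edge[OF xy(1)] by (auto simp: symmetric_generating_set_def)
      then have "inv\<^bsub>G\<^esub> s \<otimes>\<^bsub>G\<^esub> y = x" using 1 by (simp add: m_assoc[symmetric])
      then show ?thesis using 1 S by (auto simp: symmetric_generating_set_def)
    qed auto
  qed
  then show ?thesis using xy edge by blast
qed

text \<open>
  A vertex \<open>v\<close> with \<open>s v \<in> F\<close> belongs to the translate of \<open>F\<close> by the inverse of \<open>s\<close>, which is again a
  generator.
\<close>

lemma card_Cayley_boundary: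
  assumes G: "group G" and S: "symmetric_generating_set G S" "finite S"
    and F: "finite F" "F \<subseteq> carrier G"
  defines "B \<equiv> {v \<in> carrier G. v \<notin> F \<and> (\<exists>s\<in>S. s \<otimes>\<^bsub>G\<^esub> v \<in> F)}"
  shows "finite B" "card B \<le> (\<Sum>s\<in>S. card ((s <#\<^bsub>G\<^esub> F) - F))"
proof -
  interpret group G by (rule G)
  have fin: "finite ((s <#\<^bsub>G\<^esub> F) - F)" for s
    using F by (simp add: l_coset_def)
  have sub: "B \<subseteq> (\<Union>s\<in>S. (s <#\<^bsub>G\<^esub> F) - F)"
  proof
    fix v assume "v \<in> B"
    then obtain s where v: "v \<in> carrier G" "v \<notin> F" "s \<in> S" "s \<otimes>\<^bsub>G\<^esub> v \<in> F"
      by (auto simp: B_def)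
    have "s \<in> carrier G" "inv\<^bsub>G\<^esub> s \<in> S"
      using v S by (auto simp: symmetric_generating_set_def)
    moreover have "v = inv\<^bsub>G\<^esub> s \<otimes>\<^bsub>G\<^esub> (s \<otimes>\<^bsub>G\<^esub> v)"
      using v \<open>s \<in> carrier G\<close> by (simp add: m_assoc[symmetric])
    ultimately show "v \<in> (\<Union>s\<in>S. (s <#\<^bsub>G\<^esub> F) - F)"
      using v by (auto simp: l_coset_def)
  qed
  have fin': "finite (\<Union>s\<in>S. (s <#\<^bsub>G\<^esub> F) - F)"
    using S(2) fin by (rule finite_UN_I)
  show "finite B" using sub fin' by (rule finite_subset)
  have "card B \<le> card (\<Union>s\<in>S. (s <#\<^bsub>G\<^esub> F) - F)"
    using fin' sub by (rule card_mono)
  also have "\<dots> \<le> (\<Sum>s\<in>S. card ((s <#\<^bsub>G\<^esub> F) - F))"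
    using S by (intro card_UN_le)
  finally show "card B \<le> (\<Sum>s\<in>S. card ((s <#\<^bsub>G\<^esub> F) - F))" .
qed

text \<open>
  If \<open>card (F i) \<le> n\<close> and each generator and its inverse moves less than a proportion \<open>1 / (n + 1)\<close> of
  \<open>F i\<close> out of \<open>F i\<close>, then it moves less than one point, that is none.  So the finite set \<open>F i\<close> is
  invariant under the whole group, which is impossible in an infinite group.
\<close>

lemma Folner_sequence_card_at_top:
  assumes G: "group G" "infinite (carrier G)" and S: "finite S" "generate G S = carrier G"
    and F: "Folner_sequence G F"
  shows "filterlim (\<lambda>i. real (card (F i))) at_top sequentially"
proof -
  interpret group G by (rule G)
  have F': "F i \<subseteq> carrier G" "finite (F i)" "F i \<noteq> {}" for i
    using F by (auto simp: Folner_sequence_def)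
  have gen: "S \<subseteq> carrier G"
    unfolding S(2)[symmetric] by (rule subsetI) (rule generate.incl)
  have large: "\<forall>\<^sub>F i in sequentially. n < card (F i)" for n :: nat
  proof -
    have "\<forall>\<^sub>F i in sequentially. real (card ((s <#\<^bsub>G\<^esub> F i) - F i)) / real (card (F i)) < 1 / Suc n"
      if "s \<in> S \<union> m_inv G ` S" for s
    proof -
      have "s \<in> carrier G" using that gen by auto
      then have "(\<lambda>i. real (card ((s <#\<^bsub>G\<^esub> F i) - F i)) / real (card (F i))) \<longlonglongrightarrow> 0"
        using F by (simp add: Folner_sequence_def)
      then show ?thesis by (rule order_tendstoD) simp
    qed
    then have "\<forall>\<^sub>F i in sequentially. \<forall>s\<in>S \<union> m_inv G ` S.
        real (card ((s <#\<^bsub>G\<^esub> F i) - F i)) / real (card (F i)) < 1 / Suc n"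
      using S(1) by (intro eventually_ball_finite) auto
    then show ?thesis
    proof (rule eventually_mono)
      fix i
      assume small: "\<forall>s\<in>S \<union> m_inv G ` S.
        real (card ((s <#\<^bsub>G\<^esub> F i) - F i)) / real (card (F i)) < 1 / Suc n"
      show "n < card (F i)"
      proof (rule ccontr)
        assume "\<not> n < card (F i)"
        have pos: "card (F i) > 0" using F' by (simp add: card_gt_0_iff)
        have closed: "s \<otimes>\<^bsub>G\<^esub> v \<in> F i" if s: "s \<in> S \<union> m_inv G ` S" and v: "v \<in> F i" for s v
        proof -
          have "real (card ((s <#\<^bsub>G\<^esub> F i) - F i)) < real (card (F i)) / Suc n"
            using small s pos by (auto simp: divide_simps mult.commute)
          also have "\<dots> \<le> 1" using \<open>\<not> n < card (F i)\<close> by simp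
          finally have "card ((s <#\<^bsub>G\<^esub> F i) - F i) = 0" by simp
          moreover have "finite ((s <#\<^bsub>G\<^esub> F i) - F i)" using F' by (simp add: l_coset_def)
          ultimately have "(s <#\<^bsub>G\<^esub> F i) \<subseteq> F i" by auto
          then show ?thesis using v by (auto simp: l_coset_def)
        qed
        obtain v where v: "v \<in> F i" using F'(3)[of i] by auto
        have orbit: "\<forall>w\<in>F i. g \<otimes>\<^bsub>G\<^esub> w \<in> F i" if "g \<in> generate G S" for g
          using that
        proof (induction rule: generate.induct)
          case one
          then show ?case using F'(1)[of i] by (auto simp: subset_iff)
        next
          case (eng g h)
          then show ?case using F'(1)[of i] S(2) by (auto simp: m_assoc subset_iff)
        qed (use closed in auto)
        have "carrier G \<subseteq> (\<lambda>w. w \<otimes>\<^bsub>G\<^esub> inv\<^bsub>G\<^esub> v) ` F i"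
        proof
          fix g assume g: "g \<in> carrier G"
          have "v \<in> carrier G" using v F'(1)[of i] by blast
          then have "g = (g \<otimes>\<^bsub>G\<^esub> v) \<otimes>\<^bsub>G\<^esub> inv\<^bsub>G\<^esub> v" using g by (simp add: m_assoc)
          moreover have "g \<otimes>\<^bsub>G\<^esub> v \<in> F i" using orbit[of g] g v S(2) by simp
          ultimately show "g \<in> (\<lambda>w. w \<otimes>\<^bsub>G\<^esub> inv\<^bsub>G\<^esub> v) ` F i" by blast
        qed
        then show False using F'(2)[of i] G(2) by (meson finite_imageI finite_subset)
      qed
    qed
  qed
  have "filterlim (\<lambda>i. card (F i)) at_top sequentially"
    unfolding filterlim_at_top by (intro allI eventually_mono[OF large] less_imp_le)
  then show ?thesis by (rule filterlim_compose[OF filterlim_real_sequentially])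
qed

text \<open>
  Given \<open>\<epsilon>\<close>, choose \<open>L > 4 / \<epsilon>\<close>: of \<open>\<epsilon> L c i > 4 c i\<close>, one half pays for the main term \<open>2 c i\<close> and the
  other for the remaining terms, which are \<open>o(c i)\<close> once \<open>L\<close> is fixed.
\<close>

lemma smallo_of_scaled_bounds:
  fixes c b C :: "nat \<Rightarrow> nat"
  assumes c: "filterlim (\<lambda>i. real (c i)) at_top sequentially"
    and b: "(\<lambda>i. real (b i) / real (c i)) \<longlonglongrightarrow> 0"
    and bound: "\<And>L. L > 0 \<Longrightarrow> \<exists>M K. \<forall>i. L * C i \<le> 2 * c i + M * Suc (b i) + K"
  shows "(\<lambda>i. real (C i)) \<in> o(\<lambda>i. real (c i))"
proof (rule landau_o.smallI)
  fix \<epsilon> :: real assume \<epsilon>: "\<epsilon> > 0"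
  obtain L :: nat where L: "4 / \<epsilon> < L" using reals_Archimedean2 by blast
  then have "real L > 0" using \<epsilon> by (metis divide_pos_pos less_trans zero_less_numeral)
  then have "L > 0" by simp
  then obtain M K where MK: "\<And>i. L * C i \<le> 2 * c i + M * Suc (b i) + K"
    using bound by blast
  have "(\<lambda>i. 1 / real (c i)) \<longlonglongrightarrow> 0"
    using c by (intro tendsto_divide_0[OF tendsto_const] filterlim_at_top_imp_at_infinity)
  then have "(\<lambda>i. M * (real (b i) / real (c i) + 1 / real (c i)) + K * (1 / real (c i))) \<longlonglongrightarrow>
      real M * (0 + 0) + real K * 0"
    using b by (intro tendsto_add tendsto_mult tendsto_const)
  then have "\<forall>\<^sub>F i in sequentially.
      M * (real (b i) / real (c i) + 1 / real (c i)) + K * (1 / real (c i)) < 2"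
    by (rule order_tendstoD) simp
  moreover have "\<forall>\<^sub>F i in sequentially. real (c i) > 0"
    using c unfolding filterlim_at_top_dense by blast
  ultimately show "\<forall>\<^sub>F i in sequentially. norm (real (C i)) \<le> \<epsilon> * norm (real (c i))"
  proof eventually_elim
    case (elim i)
    have "M * (real (b i) + 1) + K =
        (M * (real (b i) / real (c i) + 1 / real (c i)) + K * (1 / real (c i))) * c i"
      using elim(2) by (simp add: field_simps)
    also have "\<dots> \<le> 2 * real (c i)"
      using elim by (intro mult_right_mono) auto
    finally have small: "M * (real (b i) + 1) + K \<le> 2 * real (c i)" .
    have "real (L * C i) \<le> real (2 * c i + M * Suc (b i) + K)"
      using MK of_nat_le_iff by blast
    then have "real L * real (C i) \<le> 4 * real (c i)"
      using small by (simp add: algebra_simps)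
    also have "\<dots> \<le> (real L * \<epsilon>) * real (c i)"
      using L \<epsilon> by (intro mult_right_mono) (auto simp: field_simps)
    finally have "real L * real (C i) \<le> real L * (\<epsilon> * real (c i))" by (simp add: mult.assoc)
    then show ?case using \<open>real L > 0\<close> by simp
  qed
qed

theorem theorem3p1:
  fixes G :: "(nat, 'b) monoid_scheme"
    and S :: "nat set"
    and F :: "nat \<Rightarrow> nat set"
    and f :: "bool list \<Rightarrow> bool list option"
    and q :: "nat set \<Rightarrow> nat"
  assumes "optimal f"
    and "natural_enumeration q"
    and "computable_group G"
    and "amenable G"
    and "finite S"
    and "symmetric_generating_set G S"
    and "Folner_sequence G F"
    and "\<And>i. connected_subset (cayley_graph G S) (F i)"
    and "\<And>i. \<one>\<^bsub>G\<^esub> \<in> F i"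
  shows "modest_Folner_sequence f q G F"
proof -
  have G: "group G" "carrier G = UNIV" "computable2 (\<lambda>g h. g \<otimes>\<^bsub>G\<^esub> h)"
    using assms(3) by (auto simp: computable_group_def)
  have F: "finite (F i)" "F i \<subseteq> carrier G" for i
    using assms(7) by (auto simp: Folner_sequence_def)
  have S: "S \<subseteq> carrier G" "generate G S = carrier G"
    using assms(6) by (auto simp: symmetric_generating_set_def)
  \<comment> \<open>The generating set is symmetric, so the neighbours of \<open>v\<close> are the products \<open>s v\<close>.\<close>
  define \<Phi> where "\<Phi> = (\<lambda>s v. s \<otimes>\<^bsub>G\<^esub> v) ` S"
  define B where "B = (\<lambda>i. {v \<in> carrier G. v \<notin> F i \<and> (\<exists>s\<in>S. s \<otimes>\<^bsub>G\<^esub> v \<in> F i)})"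
  have \<Phi>: "finite \<Phi>" using assms(5) by (simp add: \<Phi>_def)
  have rec: "recursive_on UNIV (\<lambda>v. [v]) \<phi>" if "\<phi> \<in> \<Phi>" for \<phi>
  proof -
    obtain s where \<phi>: "\<phi> = (\<lambda>v. s \<otimes>\<^bsub>G\<^esub> v)" using \<open>\<phi> \<in> \<Phi>\<close> by (auto simp: \<Phi>_def)
    show ?thesis unfolding \<phi>
      by (rule recursive_on_op2[OF G(3) recursive_on_const recursive_on_proj[where i = 0]]) simp
  qed
  have B: "finite (B i)" "card (B i) \<le> (\<Sum>s\<in>S. card ((s <#\<^bsub>G\<^esub> F i) - F i))" for i
    unfolding B_def using card_Cayley_boundary[OF G(1) assms(6,5) F] by auto
  have "(\<lambda>i. real (card (B i)) / real (card (F i))) \<longlonglongrightarrow> 0"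
  proof (rule tendsto_sandwich[OF _ _ tendsto_const])
    show "\<forall>\<^sub>F i in sequentially. real (card (B i)) / real (card (F i))
        \<le> (\<Sum>s\<in>S. real (card ((s <#\<^bsub>G\<^esub> F i) - F i)) / real (card (F i)))"
    proof (rule always_eventually, rule allI)
      fix i
      have "real (card (B i)) \<le> (\<Sum>s\<in>S. real (card ((s <#\<^bsub>G\<^esub> F i) - F i)))"
        using B(2)[of i] by (metis of_nat_le_iff of_nat_sum)
      then show "real (card (B i)) / real (card (F i))
          \<le> (\<Sum>s\<in>S. real (card ((s <#\<^bsub>G\<^esub> F i) - F i)) / real (card (F i)))"
        by (simp add: divide_right_mono flip: sum_divide_distrib)
    qed
    show "(\<lambda>i. \<Sum>s\<in>S. real (card ((s <#\<^bsub>G\<^esub> F i) - F i)) / real (card (F i))) \<longlonglongrightarrow> 0"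
      using assms(7) S by (intro tendsto_null_sum) (auto simp: Folner_sequence_def)
  qed auto
  moreover have "filterlim (\<lambda>i. real (card (F i))) at_top sequentially"
    using Folner_sequence_card_at_top[OF G(1) _ assms(5) S(2) assms(7)] G(2) by simp
  moreover have "\<exists>M K. \<forall>i. L * the_enat (set_complexity f q (F i))
      \<le> 2 * card (F i) + M * Suc (card (B i)) + K" if L: "L > 0" for L
  proof -
    obtain K where K: "\<forall>F B. finite F \<longrightarrow> finite B \<longrightarrow> \<one>\<^bsub>G\<^esub> \<in> F \<longrightarrow>
       (\<forall>A. A \<subset> F \<longrightarrow> \<one>\<^bsub>G\<^esub> \<in> A \<longrightarrow> (\<exists>v\<in>F - A. \<exists>\<phi>\<in>\<Phi>. \<phi> v \<in> A)) \<longrightarrow>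
       (\<forall>v. v \<notin> F \<longrightarrow> (\<exists>\<phi>\<in>\<Phi>. \<phi> v \<in> F) \<longrightarrow> v \<in> B) \<longrightarrow>
       L * the_enat (set_complexity f q F) \<le> 2 * card F + 2 * (L * L + L) * Suc (card B) + K"
      using complexity_of_explorable_set[OF assms(1,2) \<Phi> rec L] by (rule exE)
    have "L * the_enat (set_complexity f q (F i))
        \<le> 2 * card (F i) + 2 * (L * L + L) * Suc (card (B i)) + K" for i
    proof (rule K[rule_format, OF F(1) B(1) assms(9)])
      show "\<exists>v\<in>F i - A. \<exists>\<phi>\<in>\<Phi>. \<phi> v \<in> A" if "A \<subset> F i" "\<one>\<^bsub>G\<^esub> \<in> A" for A
        using connected_subset_exit[OF G(1) assms(6,8) that] by (simp add: \<Phi>_def)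
      show "v \<in> B i" if "v \<notin> F i" "\<exists>\<phi>\<in>\<Phi>. \<phi> v \<in> F i" for v
        using that G(2) by (simp add: \<Phi>_def B_def)
    qed
    then show ?thesis by (intro exI allI)
  qed
  ultimately show ?thesis
    unfolding modest_Folner_sequence_def
    by (intro conjI assms(7) smallo_of_scaled_bounds[where b = "\<lambda>i. card (B i)"])
qed

end
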